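(* Let $K\subset\mathbb{R}^n$ be a non-empty closed set with medial axis $M_K$. Then for every $x\in\mathbb{R}^n\setminus M_K$, $$\lim_{\lambda\to+\infty}M_\lambda(x;K)=0.$$
   Context: $|\cdot|$ is the Euclidean norm on $\mathbb{R}^n$ and $\mathrm{dist}(x;E)=\inf\{|x-y|: y\in E\}$ for non-empty $E$. For a non-empty closed set $K\subset\mathbb{R}^n$, the medial axis $M_K$ is the set of points $x\in\mathbb{R}^n\setminus K$ for which there are at least two different points $y_1,y_2\in K$ with $\mathrm{dist}(x;K)=|x-y_1|=|x-y_2|$. For a continuous function $f:\mathbb{R}^n\to\mathbb{R}$ bounded below, $\mathrm{co}[f]$ denotes the convex envelope, i.e. the largest convex function not greater than $f$. For $\lambda>0$ the lower compensated convex transform is $C^l_\lambda(f)(x)=\mathrm{co}[f+\lambda|\cdot|^2](x)-\lambda|x|^2$. The quadratic multiscale medial axis map of $K$ with scale $\lambda>0$ is $M_\lambda(x;K)=(1+\lambda)\big(\mathrm{dist}^2(x;K)-C^l_\lambda(\mathrm{dist}^2(\cdot;K))(x)\big)$. *)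

theory Defs
  imports "HOL-Analysis.Analysis"
begin

definition medial_axis :: "'a::euclidean_space set \<Rightarrow> 'a set" where
  "medial_axis K = {x. x \<notin> K \<and> (\<exists>y1\<in>K. \<exists>y2\<in>K. y1 \<noteq> y2 \<and>
     infdist x K = norm (x - y1) \<and> infdist x K = norm (x - y2))}"

(* GREATEST refers to the pointwise order on functions. *)
definition convex_envelope :: "('a::euclidean_space \<Rightarrow> real) \<Rightarrow> 'a \<Rightarrow> real" where
  "convex_envelope f = (GREATEST g. convex_on UNIV g \<and> g \<le> f)"

(* The greatest convex minorant exists for f bounded below: it is the pointwise
   supremum e of all convex minorants. *)
lemma convex_envelope_greatest:
  fixes f :: "'a::euclidean_space \<Rightarrow> real"
  assumes "bdd_below (range f)"
  shows convex_on_convex_envelope: "convex_on UNIV (convex_envelope f)"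
    and convex_envelope_le: "convex_envelope f \<le> f"
    and convex_envelope_upper: "\<And>g. convex_on UNIV g \<Longrightarrow> g \<le> f \<Longrightarrow> g \<le> convex_envelope f"
proof -
  define S where "S = {g. convex_on UNIV g \<and> g \<le> f}"
  define e where "e = (\<lambda>x. SUP g\<in>S. g x)"
  obtain c where c: "\<And>x. c \<le> f x"
    using assms by (auto simp: bdd_below_def)
  have "(\<lambda>_. c) \<in> S"
    using c by (auto simp: S_def le_fun_def convex_on_def simp flip: distrib_right)
  then have ne: "S \<noteq> {}" by blast
  have bdd: "bdd_above ((\<lambda>g. g x) ` S)" for x
    by (rule bdd_aboveI[of _ "f x"]) (auto simp: S_def le_fun_def)
  have upper: "g x \<le> e x" if "g \<in> S" for g x
    unfolding e_def using that bdd by (rule cSUP_upper)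
  have le: "e \<le> f"
    unfolding le_fun_def e_def using ne by (auto intro!: cSUP_least simp: S_def le_fun_def)
  have conv: "convex_on UNIV e"
  proof (rule convex_onI)
    fix t :: real and x y :: 'a
    assume t: "0 < t" "t < 1"
    have "g ((1 - t) *\<^sub>R x + t *\<^sub>R y) \<le> (1 - t) * e x + t * e y" if g: "g \<in> S" for g
    proof -
      have "g ((1 - t) *\<^sub>R x + t *\<^sub>R y) \<le> (1 - t) * g x + t * g y"
        using g t by (auto simp: S_def intro!: convex_onD)
      also have "\<dots> \<le> (1 - t) * e x + t * e y"
        using t by (intro add_mono mult_left_mono upper g) auto
      finally show ?thesis .
    qed
    then show "e ((1 - t) *\<^sub>R x + t *\<^sub>R y) \<le> (1 - t) * e x + t * e y"
      using ne by (subst e_def) (intro cSUP_least, auto)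
  qed auto
  have "convex_envelope f = e"
    unfolding convex_envelope_def
    by (rule Greatest_equality) (use conv le upper in \<open>auto simp: S_def le_fun_def\<close>)
  then show "convex_on UNIV (convex_envelope f)" "convex_envelope f \<le> f"
    "\<And>g. convex_on UNIV g \<Longrightarrow> g \<le> f \<Longrightarrow> g \<le> convex_envelope f"
    using conv le upper by (auto simp: S_def le_fun_def)
qed

definition lower_transform :: "real \<Rightarrow> ('a::euclidean_space \<Rightarrow> real) \<Rightarrow> 'a \<Rightarrow> real" where
  "lower_transform s f x =
     convex_envelope (\<lambda>y. f y + s * (norm y)\<^sup>2) x - s * (norm x)\<^sup>2"

definition medial_axis_map :: "real \<Rightarrow> 'a::euclidean_space \<Rightarrow> 'a set \<Rightarrow> real" where
  "medial_axis_map s x K =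
     (1 + s) * ((infdist x K)\<^sup>2 - lower_transform s (\<lambda>y. (infdist y K)\<^sup>2) x)"

end

theory Submission
  imports Defs
begin

text \<open>
  Off the medial axis, \<open>x\<close> has a unique nearest point \<open>p\<close> in \<open>K\<close>, and by compactness nearest points
  of \<open>x + h\<close> tend to \<open>p\<close> as \<open>h\<close> tends to 0. Hence the squared distance lies above
  \<open>dist\<^sup>2(x) + 2 (x - p) \<bullet> h - o(\<bar>h\<bar>)\<close>. Since \<open>\<eta> \<bar>h\<bar> \<le> \<lambda> \<bar>h\<bar>\<^sup>2 + \<eta>\<^sup>2 / (4\<lambda>)\<close>, it lies above
  \<open>dist\<^sup>2(x) + 2 (x - p) \<bullet> h - \<lambda> \<bar>h\<bar>\<^sup>2 - o(1/\<lambda>)\<close>, for all \<open>h\<close> once \<open>\<lambda>\<close> is large. Adding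
  \<open>\<lambda> \<bar>x + h\<bar>\<^sup>2\<close> turns this minorant into an affine one, which bounds the convex envelope from below.
\<close>

lemma convex_on_affine_inner:
  fixes w :: "'a::real_inner"
  shows "convex_on UNIV (\<lambda>y. c + w \<bullet> y)"
  by (rule convex_onI) (auto simp: inner_add_right algebra_simps)

lemma lower_transform_le:
  fixes f :: "'a::euclidean_space \<Rightarrow> real"
  assumes "0 \<le> s" and "\<And>y. 0 \<le> f y"
  shows "lower_transform s f x \<le> f x"
proof -
  have "bdd_below (range (\<lambda>y. f y + s * (norm y)\<^sup>2))"
    using assms by (intro bdd_belowI[of _ 0]) auto
  from convex_envelope_le[OF this] show ?thesis
    by (auto simp: lower_transform_def le_fun_def algebra_simps)
qed

lemma lower_transform_ge:
  fixes f :: "'a::euclidean_space \<Rightarrow> real"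
  assumes "0 \<le> s" and "\<And>y. 0 \<le> f y"
    and minorant: "\<And>y. c + w \<bullet> (y - x) - s * (norm (y - x))\<^sup>2 \<le> f y"
  shows "c \<le> lower_transform s f x"
proof -
  \<comment> \<open>Expanding \<open>norm (y - x)\<close> makes the quadratic terms cancel, so
    \<open>g\<close> is the given minorant plus \<open>s * (norm y)\<^sup>2\<close> and yet affine,
    hence convex.\<close>
  define g where "g y = (c - w \<bullet> x - s * (norm x)\<^sup>2) + (w + (2 * s) *\<^sub>R x) \<bullet> y" for y
  have g_eq: "g y = c + w \<bullet> (y - x) - s * (norm (y - x))\<^sup>2 + s * (norm y)\<^sup>2" for y
    by (simp add: g_def power2_norm_eq_inner inner_commute algebra_simps)
  have "bdd_below (range (\<lambda>y. f y + s * (norm y)\<^sup>2))"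
    using assms by (intro bdd_belowI[of _ 0]) auto
  moreover have "convex_on UNIV g"
    unfolding g_def by (rule convex_on_affine_inner)
  moreover have "g \<le> (\<lambda>y. f y + s * (norm y)\<^sup>2)"
    using minorant by (auto simp: le_fun_def g_eq)
  ultimately have "g \<le> convex_envelope (\<lambda>y. f y + s * (norm y)\<^sup>2)"
    by (rule convex_envelope_upper)
  then have "g x \<le> convex_envelope (\<lambda>y. f y + s * (norm y)\<^sup>2) x"
    by (simp add: le_fun_def)
  then show ?thesis
    by (simp add: g_eq lower_transform_def)
qed

text \<open>The part of \<open>K\<close> outside the ball about \<open>p\<close> is closed, so its
  distance to \<open>x\<close> is attained and, by uniqueness, exceeds \<open>infdist x K\<close> by
  a positive gap. A small move of \<open>x\<close> cannot close this gap.\<close>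

lemma nearest_point_near_unique:
  fixes K :: "'a::euclidean_space set"
  assumes "closed K" and unique: "\<And>q. q \<in> K \<Longrightarrow> dist x q = infdist x K \<Longrightarrow> q = p"
    and "\<eta> > 0"
  obtains \<delta> where "\<delta> > 0"
    and "\<And>y q. dist x y < \<delta> \<Longrightarrow> q \<in> K \<Longrightarrow> dist y q = infdist y K \<Longrightarrow> dist p q < \<eta>"
proof (cases "K - ball p \<eta> = {}")
  case True
  then show ?thesis by (intro that[of 1]) auto
next
  case False
  have "closed (K - ball p \<eta>)" using \<open>closed K\<close> by auto
  from infdist_attains_inf[OF this False]
  obtain q0 where q0: "q0 \<in> K - ball p \<eta>" "infdist x (K - ball p \<eta>) = dist x q0"
    by blast
  \<comment> \<open>Half the gap, because moving from \<open>x\<close> to \<open>y\<close> costs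
    \<open>dist x y\<close> twice: once in the distance to \<open>q\<close> and once in the distance
    to \<open>K\<close>.\<close>
  define \<delta> where "\<delta> = (dist x q0 - infdist x K) / 2"
  have "q0 \<noteq> p" using q0 \<open>\<eta> > 0\<close> by auto
  then have "infdist x K \<noteq> dist x q0" using unique[of q0] q0 by auto
  moreover have "infdist x K \<le> dist x q0" using q0 by (intro infdist_le) auto
  ultimately have "\<delta> > 0" by (simp add: \<delta>_def)
  moreover have "dist p q < \<eta>"
    if "dist x y < \<delta>" "q \<in> K" "dist y q = infdist y K" for y q
  proof (rule ccontr)
    assume "\<not> dist p q < \<eta>"
    then have "dist x q0 \<le> dist x q"
      using infdist_le[of q "K - ball p \<eta>" x] that q0 by auto
    also have "\<dots> \<le> dist x y + infdist y K"
      using dist_triangle[of x q y] that by simp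
    also have "\<dots> \<le> 2 * dist x y + infdist x K"
      using infdist_triangle[of y K x] by (simp add: dist_commute)
    finally show False using that by (simp add: \<delta>_def)
  qed
  ultimately show ?thesis by (rule that)
qed

text \<open>For \<open>q\<close> nearest to \<open>y\<close>, expand the square of
  \<open>y - q\<close> about \<open>x\<close>. The constant term is at least
  \<open>(infdist x K)\<^sup>2\<close>, and replacing \<open>q\<close> by \<open>p\<close> in the
  linear term costs at most \<open>2 * \<eta> * norm (y - x)\<close>, since \<open>q\<close> is
  close to \<open>p\<close>.\<close>

lemma infdist_sq_lower_expansion:
  fixes K :: "'a::euclidean_space set"
  assumes "closed K" and "K \<noteq> {}"
    and unique: "\<And>q. q \<in> K \<Longrightarrow> dist x q = infdist x K \<Longrightarrow> q = p"
    and "\<eta> > 0"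
  obtains \<delta> where "\<delta> > 0"
    and "\<And>y. dist x y < \<delta> \<Longrightarrow>
      (infdist x K)\<^sup>2 + (2 *\<^sub>R (x - p)) \<bullet> (y - x) - 2 * \<eta> * norm (y - x) \<le> (infdist y K)\<^sup>2"
proof -
  obtain \<delta> where "\<delta> > 0"
    and \<delta>: "\<And>y q. dist x y < \<delta> \<Longrightarrow> q \<in> K \<Longrightarrow> dist y q = infdist y K \<Longrightarrow> dist p q < \<eta>"
    using nearest_point_near_unique[OF assms(1) unique \<open>\<eta> > 0\<close>] by blast
  have "(infdist x K)\<^sup>2 + (2 *\<^sub>R (x - p)) \<bullet> (y - x) - 2 * \<eta> * norm (y - x) \<le> (infdist y K)\<^sup>2"
    if y: "dist x y < \<delta>" for y
  proof -
    obtain q where q: "q \<in> K" "infdist y K = dist y q"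
      using infdist_attains_inf[OF assms(1,2)] by blast
    have "(infdist x K)\<^sup>2 \<le> (norm (x - q))\<^sup>2"
      using infdist_le[OF q(1), of x] by (simp add: dist_norm infdist_nonneg power_mono)
    moreover have "(infdist y K)\<^sup>2 = (norm (x - q))\<^sup>2 + (2 *\<^sub>R (x - p)) \<bullet> (y - x)
        - 2 * ((q - p) \<bullet> (y - x)) + (norm (y - x))\<^sup>2"
      unfolding q(2) dist_norm
      by (simp add: power2_norm_eq_inner inner_commute algebra_simps)
    moreover have "(q - p) \<bullet> (y - x) \<le> \<eta> * norm (y - x)"
    proof -
      have "(q - p) \<bullet> (y - x) \<le> norm (q - p) * norm (y - x)" by (rule norm_cauchy_schwarz)
      also have "\<dots> \<le> \<eta> * norm (y - x)"
        using \<delta>[OF y q(1)] q(2) by (intro mult_right_mono) (auto simp: dist_norm norm_minus_commute)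
      finally show ?thesis .
    qed
    ultimately show ?thesis using zero_le_power2[of "norm (y - x)"] by linarith
  qed
  with \<open>\<delta> > 0\<close> show ?thesis by (rule that)
qed

lemma unique_nearest_point_off_medial_axis:
  fixes K :: "'a::euclidean_space set"
  assumes "closed K" and "K \<noteq> {}" and "x \<notin> medial_axis K"
  obtains p where "\<And>q. q \<in> K \<Longrightarrow> dist x q = infdist x K \<Longrightarrow> q = p"
proof -
  obtain p where p: "p \<in> K" "infdist x K = dist x p"
    using infdist_attains_inf[OF assms(1,2)] by blast
  show ?thesis
  proof (rule that)
    fix q assume "q \<in> K" "dist x q = infdist x K"
    then show "q = p"
      \<comment> \<open>If \<open>x \<in> K\<close>, which the medial axis excludes by definition,
        the distance is 0 and both points equal \<open>x\<close>. Otherwise two distinct nearest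
        points would put \<open>x\<close> on the medial axis.\<close>
      using p assms(3) by (cases "x \<in> K") (auto simp: medial_axis_def dist_norm)
  qed
qed

text \<open>Near \<open>x\<close>, completing the square absorbs the linear error of the local
  expansion. Far from \<open>x\<close>, the term \<open>- s * (norm (y - x))\<^sup>2\<close> makes
  the left side nonpositive once \<open>s\<close> is large.\<close>

lemma eventually_infdist_sq_quadratic_minorant:
  fixes K :: "'a::euclidean_space set"
  assumes "closed K" and "K \<noteq> {}"
    and unique: "\<And>q. q \<in> K \<Longrightarrow> dist x q = infdist x K \<Longrightarrow> q = p"
    and "\<eta> > 0"
  shows "\<forall>\<^sub>F s in at_top. \<forall>y.
    (infdist x K)\<^sup>2 - \<eta>\<^sup>2 / s + (2 *\<^sub>R (x - p)) \<bullet> (y - x) - s * (norm (y - x))\<^sup>2 \<le> (infdist y K)\<^sup>2"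
proof -
  let ?w = "2 *\<^sub>R (x - p)"
  obtain \<delta> where "\<delta> > 0"
    and \<delta>: "\<And>y. dist x y < \<delta> \<Longrightarrow>
      (infdist x K)\<^sup>2 + ?w \<bullet> (y - x) - 2 * \<eta> * norm (y - x) \<le> (infdist y K)\<^sup>2"
    using infdist_sq_lower_expansion[OF assms(1,2) unique \<open>\<eta> > 0\<close>] by blast
  \<comment> \<open>For \<open>r \<ge> \<delta>\<close> one has
    \<open>1 \<le> r\<^sup>2 / \<delta>\<^sup>2\<close> and
    \<open>r \<le> r\<^sup>2 / \<delta>\<close>, so \<open>S * r\<^sup>2\<close> dominates both the
    constant and the linear term.\<close>
  define S where "S = (infdist x K)\<^sup>2 / \<delta>\<^sup>2 + norm ?w / \<delta>"
  have "(infdist x K)\<^sup>2 - \<eta>\<^sup>2 / s + ?w \<bullet> (y - x) - s * (norm (y - x))\<^sup>2 \<le> (infdist y K)\<^sup>2"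
    if "s > 0" "s \<ge> S" for s y
  proof (cases "dist x y < \<delta>")
    case True
    have "0 \<le> (s * norm (y - x) - \<eta>)\<^sup>2 / s" using \<open>s > 0\<close> by simp
    also have "\<dots> = s * (norm (y - x))\<^sup>2 - 2 * \<eta> * norm (y - x) + \<eta>\<^sup>2 / s"
      using \<open>s > 0\<close> by (simp add: field_simps power2_eq_square)
    finally show ?thesis using \<delta>[OF True] by linarith
  next
    case False
    define r where "r = norm (y - x)"
    have r: "\<delta> \<le> r" using False by (simp add: r_def dist_norm norm_minus_commute)
    have "(infdist x K)\<^sup>2 * 1 \<le> (infdist x K)\<^sup>2 * (r\<^sup>2 / \<delta>\<^sup>2)"
      using r \<open>\<delta> > 0\<close> by (intro mult_left_mono) (auto simp: power_mono)
    moreover have "?w \<bullet> (y - x) \<le> norm ?w * (r\<^sup>2 / \<delta>)"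
    proof -
      have "?w \<bullet> (y - x) \<le> norm ?w * r" unfolding r_def by (rule norm_cauchy_schwarz)
      also have "r \<le> r\<^sup>2 / \<delta>"
        using r \<open>\<delta> > 0\<close> by (simp add: pos_le_divide_eq power2_eq_square)
      finally show ?thesis by (simp add: mult_left_mono)
    qed
    moreover have "(infdist x K)\<^sup>2 * (r\<^sup>2 / \<delta>\<^sup>2) + norm ?w * (r\<^sup>2 / \<delta>) = S * r\<^sup>2"
      by (simp add: S_def algebra_simps)
    moreover have "S * r\<^sup>2 \<le> s * r\<^sup>2" using \<open>s \<ge> S\<close> by (rule mult_right_mono) simp
    moreover have "0 \<le> \<eta>\<^sup>2 / s" using \<open>s > 0\<close> by simp
    ultimately show ?thesis
      unfolding r_def using zero_le_power2[of "infdist y K"] by linarith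
  qed
  then show ?thesis
    by (intro eventually_elim2[OF eventually_gt_at_top[of 0] eventually_ge_at_top[of S]] allI)
qed

theorem proposition3p20:
  fixes K :: "(real ^ 'n) set" and x :: "real ^ 'n"
  assumes "closed K" and "K \<noteq> {}" and "x \<notin> medial_axis K"
  shows "((\<lambda>s. medial_axis_map s x K) \<longlongrightarrow> 0) at_top"
proof (rule tendstoI)
  fix e :: real assume "e > 0"
  obtain p where unique: "\<And>q. q \<in> K \<Longrightarrow> dist x q = infdist x K \<Longrightarrow> q = p"
    using unique_nearest_point_off_medial_axis[OF assms] by blast
  \<comment> \<open>For \<open>s \<ge> 1\<close> the factor \<open>(1 + s) / s\<close> is at most 2,
    so the map is bounded by \<open>2 * \<eta>\<^sup>2\<close>, which this choice makes
    \<open>2 * e / 3\<close>.\<close>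
  define \<eta> where "\<eta> = sqrt (e / 3)"
  have "\<eta> > 0" and \<eta>_sq: "\<eta>\<^sup>2 = e / 3" using \<open>e > 0\<close> by (simp_all add: \<eta>_def)
  have "\<forall>\<^sub>F s in at_top. \<forall>y. (infdist x K)\<^sup>2 - \<eta>\<^sup>2 / s + (2 *\<^sub>R (x - p)) \<bullet> (y - x)
      - s * (norm (y - x))\<^sup>2 \<le> (infdist y K)\<^sup>2"
    using assms(1,2) unique \<open>\<eta> > 0\<close> by (rule eventually_infdist_sq_quadratic_minorant)
  with eventually_ge_at_top[of 1]
  show "\<forall>\<^sub>F s in at_top. dist (medial_axis_map s x K) 0 < e"
  proof eventually_elim
    case (elim s)
    define C where "C = lower_transform s (\<lambda>y. (infdist y K)\<^sup>2) x"
    have "C \<le> (infdist x K)\<^sup>2"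
      unfolding C_def using elim by (intro lower_transform_le) auto
    then have "0 \<le> medial_axis_map s x K"
      using elim by (simp add: medial_axis_map_def C_def)
    have "(infdist x K)\<^sup>2 - \<eta>\<^sup>2 / s \<le> C"
      unfolding C_def using elim by (intro lower_transform_ge[where w = "2 *\<^sub>R (x - p)"]) auto
    then have "medial_axis_map s x K \<le> (1 + s) * (\<eta>\<^sup>2 / s)"
      unfolding medial_axis_map_def C_def using elim by (intro mult_left_mono) auto
    also have "\<dots> \<le> 2 * \<eta>\<^sup>2"
      using elim(1) mult_right_mono[of 1 s "\<eta>\<^sup>2"] by (simp add: field_simps)
    also have "\<dots> < e" using \<open>e > 0\<close> by (simp add: \<eta>_sq)
    finally show ?case using \<open>0 \<le> medial_axis_map s x K\<close> by simp
  qed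
qed

end
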